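(* Let $\mathcal A_1,\mathcal A_2\subseteq\mathbb N$ be such that for every $m\in\mathcal A_1$ there exists $n\in\mathcal A_2$ with $m\le n$. Then for every environment $L$ and term $T$, if $L\vdash_{\mathcal A_1}T$ then $L\vdash_{\mathcal A_2}T$.
   Context: Fix a nonempty set $\Sigma$ of sorts with decidable equality, an arbitrary function $\mathrm{next}:\Sigma\to\Sigma$, and a countably infinite set of variables. Terms and environments: $T,U,V,W ::= \star s \mid x \mid \mathrm{app}(V,T) \mid \lambda x{:}W.\,T \mid \mathrm{def}(x{=}V).\,T \mid \mathrm{cast}(U,T)$ ($s\in\Sigma$) and $L,K ::= \emptyset \mid K,x{:}W \mid K,x{=}V$. $\mathrm{app}(V,T)$ applies $T$ to $V$; $\lambda x{:}W.\,T$ (de Bruijn's abstraction) and $\mathrm{def}(x{=}V).\,T$ (local definition) bind $x$ in $T$; $\mathrm{cast}(U,T)$ annotates $T$ with expected type $U$; entries $x{:}W$ and $x{=}V$ bind $x$. Terms are modulo renaming of bound variables. Write $\mathsf{B}x[V]$ for either $\lambda x{:}V$ or $\mathrm{def}(x{=}V)$ and correspondingly $L,x[V]$ for $L,x{:}V$ resp. $L,x{=}V$. One step of bound rt-reduction $L\vdash T_1\to^nT_2$ is the smallest relation closed under: $L\vdash\mathrm{app}(V,\lambda x{:}W.\,T)\to^0\mathrm{def}(x{=}\mathrm{cast}(W,V)).\,T$; $K,x{=}V\vdash x\to^0V$; $L\vdash\mathrm{def}(x{=}V).\,T\to^0T$ if $x$ not free in $T$; $L\vdash\mathrm{app}(V,\mathrm{def}(x{=}W).\,T)\to^0\mathrm{def}(x{=}W).\,\mathrm{app}(V,T)$;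 $L\vdash\mathrm{cast}(U,T)\to^0T$; $L\vdash\star s\to^1\star\,\mathrm{next}(s)$; $K,x{:}W\vdash x\to^1W$; $L\vdash\mathrm{cast}(U,T)\to^1U$; if $K\vdash x\to^nT$, $y\neq x$, $y$ not free in $T$ then $K,y[V]\vdash x\to^nT$; if $L\vdash V_1\to^0V_2$ then $L\vdash\mathrm{app}(V_1,T)\to^0\mathrm{app}(V_2,T)$; if $L\vdash T_1\to^nT_2$ then $L\vdash\mathrm{app}(V,T_1)\to^n\mathrm{app}(V,T_2)$; if $L\vdash V_1\to^0V_2$ then $L\vdash\mathsf Bx[V_1].\,T\to^0\mathsf Bx[V_2].\,T$; if $L,x[V]\vdash T_1\to^nT_2$ then $L\vdash\mathsf Bx[V].\,T_1\to^n\mathsf Bx[V].\,T_2$; if $L\vdash U_1\to^0U_2$ then $L\vdash\mathrm{cast}(U_1,T)\to^0\mathrm{cast}(U_2,T)$; if $L\vdash T_1\to^0T_2$ then $L\vdash\mathrm{cast}(U,T_1)\to^0\mathrm{cast}(U,T_2)$; if $L\vdash U_1\to^1U_2$ and $L\vdash T_1\to^1T_2$ then $L\vdash\mathrm{cast}(U_1,T_1)\to^1\mathrm{cast}(U_2,T_2)$. $L\vdash T_1\to^{*n}T_2$ is the smallest relation with $L\vdash T\to^{*0}T$, containing single steps, and with $L\vdash T_1\to^{*n_1}T$, $L\vdash T\to^{*n_2}T_2$ implying $L\vdash T_1\to^{*n_1+n_2}T_2$. For $\mathcal A\subseteq\mathbb N$, validity $L\vdash_{\mathcal A}T$ is the smallest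 predicate closed under: $L\vdash_{\mathcal A}\star s$; if $K\vdash_{\mathcal A}V$ then $K,x[V]\vdash_{\mathcal A}x$; if $K\vdash_{\mathcal A}x$ and $y\neq x$ then $K,y[V]\vdash_{\mathcal A}x$; if $L\vdash_{\mathcal A}V$ and $L,x[V]\vdash_{\mathcal A}T$ then $L\vdash_{\mathcal A}\mathsf Bx[V].\,T$; if $L\vdash_{\mathcal A}U$, $L\vdash_{\mathcal A}T$ and some $U_0$ satisfies $L\vdash T\to^{*1}U_0$, $L\vdash U\to^{*0}U_0$, then $L\vdash_{\mathcal A}\mathrm{cast}(U,T)$; if $L\vdash_{\mathcal A}V$, $L\vdash_{\mathcal A}T$ and there are $n\in\mathcal A$, $x,W_0,U_0$ with $L\vdash T\to^{*n}\lambda x{:}W_0.\,U_0$ and $L\vdash V\to^{*1}W_0$, then $L\vdash_{\mathcal A}\mathrm{app}(V,T)$. *)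

theory Defs
  imports Main
begin

text \<open>
  Terms modulo renaming of bound variables are represented by de Bruijn indices. The environment
  binds variables too, so index \<open>i\<close> below \<open>k\<close> binders denotes, for \<open>i \<ge> k\<close>, the entry number
  \<open>i - k\<close> of the environment counted from the most recent one. Sorts are the elements of an
  arbitrary type \<open>'s\<close>; the function \<open>nxt\<close> on sorts is a parameter of every relation below.

  \<open>Bind b V T\<close> is the generic binder \<open>Bx[V].T\<close>: the index 0 is bound in \<open>T\<close> and not in \<open>V\<close>.
\<close>

datatype bkind = Abst | Abbr

datatype 's trm =
    Sort 's
  | Var nat
  | App "'s trm" "'s trm"  \<comment> \<open>\<open>App V T\<close> applies \<open>T\<close> to \<open>V\<close>\<close>
  | Bind bkind "'s trm" "'s trm"
  | Cast "'s trm" "'s trm"  \<comment> \<open>\<open>Cast U T\<close> annotates \<open>T\<close> with the expected type \<open>U\<close>\<close>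

abbreviation Lam :: "'s trm \<Rightarrow> 's trm \<Rightarrow> 's trm" where
  "Lam W T \<equiv> Bind Abst W T"

abbreviation Def :: "'s trm \<Rightarrow> 's trm \<Rightarrow> 's trm" where
  "Def V T \<equiv> Bind Abbr V T"

text \<open>The head of the list is the most recent entry: \<open>(b, V) # K\<close> is \<open>K, x[V]\<close>.\<close>

type_synonym 's env = "(bkind \<times> 's trm) list"

text \<open>
  \<open>lift k T\<close> inserts a fresh variable at position \<open>k\<close>. A term has the form \<open>lift 0 T\<close> iff the
  variable with index 0 is not free in it; lifting is also what makes a term over \<open>K\<close> a term
  over \<open>e # K\<close> (an identity when variables are named).
\<close>

primrec lift :: "nat \<Rightarrow> 's trm \<Rightarrow> 's trm" where
  "lift k (Sort s) = Sort s"
| "lift k (Var i) = Var (if i < k then i else Suc i)"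
| "lift k (App V T) = App (lift k V) (lift k T)"
| "lift k (Bind b V T) = Bind b (lift k V) (lift (Suc k) T)"
| "lift k (Cast U T) = Cast (lift k U) (lift k T)"

inductive rt_step :: "('s \<Rightarrow> 's) \<Rightarrow> 's env \<Rightarrow> nat \<Rightarrow> 's trm \<Rightarrow> 's trm \<Rightarrow> bool"
  for nxt :: "'s \<Rightarrow> 's" where
  beta: "rt_step nxt L 0 (App V (Lam W T)) (Def (Cast W V) T)"
| delta: "rt_step nxt ((Abbr, V) # K) 0 (Var 0) (lift 0 V)"
| zeta: "rt_step nxt L 0 (Def V (lift 0 T)) T"
| theta: "rt_step nxt L 0 (App V (Def W T)) (Def W (App (lift 0 V) T))"
| eps: "rt_step nxt L 0 (Cast U T) T"
| sort: "rt_step nxt L 1 (Sort s) (Sort (nxt s))"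
| ldef: "rt_step nxt ((Abst, W) # K) 1 (Var 0) (lift 0 W)"
| ee: "rt_step nxt L 1 (Cast U T) U"
| lref: "rt_step nxt K n (Var i) T \<Longrightarrow> rt_step nxt ((b, V) # K) n (Var (Suc i)) (lift 0 T)"
| app_l: "rt_step nxt L 0 V1 V2 \<Longrightarrow> rt_step nxt L 0 (App V1 T) (App V2 T)"
| app_r: "rt_step nxt L n T1 T2 \<Longrightarrow> rt_step nxt L n (App V T1) (App V T2)"
| bind_l: "rt_step nxt L 0 V1 V2 \<Longrightarrow> rt_step nxt L 0 (Bind b V1 T) (Bind b V2 T)"
| bind_r: "rt_step nxt ((b, V) # L) n T1 T2 \<Longrightarrow> rt_step nxt L n (Bind b V T1) (Bind b V T2)"
| cast_l: "rt_step nxt L 0 U1 U2 \<Longrightarrow> rt_step nxt L 0 (Cast U1 T) (Cast U2 T)"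
| cast_r: "rt_step nxt L 0 T1 T2 \<Longrightarrow> rt_step nxt L 0 (Cast U T1) (Cast U T2)"
| cast_both: "\<lbrakk>rt_step nxt L 1 U1 U2; rt_step nxt L 1 T1 T2\<rbrakk>
    \<Longrightarrow> rt_step nxt L 1 (Cast U1 T1) (Cast U2 T2)"

inductive rt_steps :: "('s \<Rightarrow> 's) \<Rightarrow> 's env \<Rightarrow> nat \<Rightarrow> 's trm \<Rightarrow> 's trm \<Rightarrow> bool"
  for nxt :: "'s \<Rightarrow> 's" where
  refl: "rt_steps nxt L 0 T T"
| step: "rt_step nxt L n T1 T2 \<Longrightarrow> rt_steps nxt L n T1 T2"
| trans: "\<lbrakk>rt_steps nxt L n1 T1 T; rt_steps nxt L n2 T T2\<rbrakk> \<Longrightarrow> rt_steps nxt L (n1 + n2) T1 T2"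

inductive valid :: "('s \<Rightarrow> 's) \<Rightarrow> nat set \<Rightarrow> 's env \<Rightarrow> 's trm \<Rightarrow> bool"
  for nxt :: "'s \<Rightarrow> 's" and A :: "nat set" where
  sort: "valid nxt A L (Sort s)"
| zero: "valid nxt A K V \<Longrightarrow> valid nxt A ((b, V) # K) (Var 0)"
| lref: "valid nxt A K (Var i) \<Longrightarrow> valid nxt A ((b, V) # K) (Var (Suc i))"
| bind: "\<lbrakk>valid nxt A L V; valid nxt A ((b, V) # L) T\<rbrakk> \<Longrightarrow> valid nxt A L (Bind b V T)"
| cast: "\<lbrakk>valid nxt A L U; valid nxt A L T; rt_steps nxt L 1 T U0; rt_steps nxt L 0 U U0\<rbrakk>
    \<Longrightarrow> valid nxt A L (Cast U T)"
| app: "\<lbrakk>valid nxt A L V; valid nxt A L T; n \<in> A;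
      rt_steps nxt L n T (Lam W0 U0); rt_steps nxt L 1 V W0\<rbrakk>
    \<Longrightarrow> valid nxt A L (App V T)"

end

theory Submission
  imports Defs
begin

text \<open>
  Preservation of validity under reduction is not needed. Validity implies that every variable
  reachable from the term through the environment is declared. This scoping property is stable
  under reduction, and each scoped term has a reduct at bound 1, since casts can be replaced by
  their annotation and declared variables by their type or their unfolding. Hence a reduction to
  an abstraction at bound \<open>m\<close> extends, inside the body of the abstraction, to any bound \<open>n \<ge> m\<close>
  with the same expected type.
\<close>

text \<open>These are the rules of \<open>valid\<close> stripped of their reduction premises.
  \<open>Zero\<close> still looks into the entry, because \<open>delta\<close> and
  \<open>ldef\<close> bring its term into the reduct.\<close>

inductive scoped :: "'s env \<Rightarrow> 's trm \<Rightarrow> bool" where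
  Sort: "scoped L (Sort s)"
| Zero: "scoped K V \<Longrightarrow> scoped ((b, V) # K) (Var 0)"
| Suc: "scoped K (Var i) \<Longrightarrow> scoped ((b, V) # K) (Var (Suc i))"
| App: "\<lbrakk>scoped L V; scoped L T\<rbrakk> \<Longrightarrow> scoped L (App V T)"
| Bind: "\<lbrakk>scoped L V; scoped ((b, V) # L) T\<rbrakk> \<Longrightarrow> scoped L (Bind b V T)"
| Cast: "\<lbrakk>scoped L U; scoped L T\<rbrakk> \<Longrightarrow> scoped L (Cast U T)"

inductive_simps scoped_simps [simp]:
  "scoped L (Sort s)"
  "scoped ((b, V) # K) (Var 0)"
  "scoped ((b, V) # K) (Var (Suc i))"
  "scoped L (App V T)"
  "scoped L (Bind b V T)"
  "scoped L (Cast U T)"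

lemma valid_imp_scoped: "valid nxt A L T \<Longrightarrow> scoped L T"
  by (induction rule: valid.induct) simp_all

text \<open>Scoping depends on the environment only through the variables that are scoped in it, so
  a hypothesis on variables suffices.\<close>

lemma scoped_lift_iff:
  assumes "\<And>i. scoped L' (lift k (Var i)) \<longleftrightarrow> scoped L (Var i)"
  shows "scoped L' (lift k T) \<longleftrightarrow> scoped L T"
  using assms
proof (induction T arbitrary: k L L')
  case (Bind b V T)
  have V: "scoped L' (lift k V) \<longleftrightarrow> scoped L V"
    using Bind.IH(1) Bind.prems by blast
  \<comment> \<open>Index 0 is settled by \<open>V\<close>; a positive \<open>i\<close> falls under
    the hypothesis at \<open>i - 1\<close>.\<close>
  have "scoped ((b, lift k V) # L') (lift (Suc k) (Var i)) \<longleftrightarrow> scoped ((b, V) # L) (Var i)" for i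
    using V Bind.prems[of "i - 1"] by (cases i) (auto split: if_splits)
  then have "scoped ((b, lift k V) # L') (lift (Suc k) T) \<longleftrightarrow> scoped ((b, V) # L) T"
    by (rule Bind.IH(2))
  with V show ?case by simp
qed simp_all

lemma scoped_lift_0_iff [simp]: "scoped ((b, V) # L) (lift 0 T) \<longleftrightarrow> scoped L T"
  by (rule scoped_lift_iff) simp

lemma scoped_mono:
  assumes "scoped L T" and "\<And>i. scoped L (Var i) \<Longrightarrow> scoped L' (Var i)"
  shows "scoped L' T"
  using assms
proof (induction T arbitrary: L L' rule: trm.induct)
  case (Bind b V T)
  have V: "scoped L' V"
    using Bind.IH(1)[of L L'] Bind.prems by simp
  have "scoped ((b, V) # L') (Var i)" if "scoped ((b, V) # L) (Var i)" for i
    using that V Bind.prems(2) by (cases i) auto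
  then have "scoped ((b, V) # L') T"
    using Bind.IH(2)[of "(b, V) # L"] Bind.prems(1) by simp
  with V show ?case by simp
qed auto

text \<open>Serves the steps that change the entry above an unchanged body: \<open>beta\<close>
  turns an abstraction into a definition, and \<open>bind_l\<close> reduces the entry.\<close>

lemma scoped_replace_entry:
  assumes "scoped ((b, V) # L) T" and "scoped L V'"
  shows "scoped ((b', V') # L) T"
  using assms(1)
proof (rule scoped_mono)
  show "scoped ((b', V') # L) (Var i)" if "scoped ((b, V) # L) (Var i)" for i
    using that assms(2) by (cases i) auto
qed

lemma scoped_rt_step: "rt_step nxt L n T U \<Longrightarrow> scoped L T \<Longrightarrow> scoped L U"
  by (induction rule: rt_step.induct) (auto intro: scoped_replace_entry)

lemma scoped_rt_steps: "rt_steps nxt L n T U \<Longrightarrow> scoped L T \<Longrightarrow> scoped L U"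
  by (induction rule: rt_steps.induct) (auto intro: scoped_rt_step)

lemma lift_lift: "j \<le> k \<Longrightarrow> lift (Suc k) (lift j T) = lift j (lift k T)"
  by (induction T arbitrary: j k) auto

text \<open>Weakening at arbitrary depth, so that an induction on steps can pass under binders. The
  head entry is a term over the older entries only, hence it is lifted at \<open>k\<close> and not
  at \<open>Suc k\<close>.\<close>

inductive insert_entry :: "nat \<Rightarrow> 's env \<Rightarrow> 's env \<Rightarrow> bool" where
  here: "insert_entry 0 L ((b, V) # L)"
| there: "insert_entry k L L' \<Longrightarrow> insert_entry (Suc k) ((b, V) # L) ((b, lift k V) # L')"

inductive_cases insert_entry_ConsE [consumes 1, case_names here there]: "insert_entry k ((b, V) # L) L'"

lemma rt_step_lift:
  "rt_step nxt L n T U \<Longrightarrow> insert_entry k L L' \<Longrightarrow> rt_step nxt L' n (lift k T) (lift k U)"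
proof (induction arbitrary: k L' rule: rt_step.induct)
  case (delta V K)
  from delta show ?case
  proof (cases rule: insert_entry_ConsE)
    \<comment> \<open>A new most recent entry shifts the variable, so \<open>lref\<close> prolongs
      the step; a deeper insertion only requires commuting two lifts.\<close>
    case (here b' V')
    then show ?thesis
      using rt_step.lref[OF rt_step.delta] by simp
  next
    case (there k' L'')
    then show ?thesis by (simp add: lift_lift rt_step.delta)
  qed
next
  case (ldef W K)
  from ldef show ?case
  proof (cases rule: insert_entry_ConsE)
    case (here b' V')
    then show ?thesis
      using rt_step.lref[OF rt_step.ldef] by simp
  next
    case (there k' L'')
    then show ?thesis using rt_step.ldef by (simp add: lift_lift)
  qed
next
  case (lref K n i T b V)
  from lref.prems show ?case
  proof (cases rule: insert_entry_ConsE)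
    case (here b' V')
    then show ?thesis
      using rt_step.lref[OF rt_step.lref[OF lref.hyps]] by simp
  next
    case (there k' L'')
    then show ?thesis
      using lref.IH[of k' L''] by (auto simp: lift_lift dest: rt_step.lref)
  qed
next
  case (zeta L V T)
  then show ?case by (simp add: lift_lift rt_step.zeta)
next
  case (theta L V W T)
  then show ?case by (simp add: lift_lift rt_step.theta)
qed (auto intro: rt_step.intros[simplified] insert_entry.there)

lemma rt_steps_lift:
  "rt_steps nxt L n T U \<Longrightarrow> insert_entry k L L' \<Longrightarrow> rt_steps nxt L' n (lift k T) (lift k U)"
  by (induction rule: rt_steps.induct) (auto intro: rt_steps.intros rt_step_lift)

lemma rt_steps_lift_0: "rt_steps nxt L n T U \<Longrightarrow> rt_steps nxt ((b, V) # L) n (lift 0 T) (lift 0 U)"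
  by (erule rt_steps_lift) (rule insert_entry.here)

lemma rt_steps_App: "rt_steps nxt L n T U \<Longrightarrow> rt_steps nxt L n (App V T) (App V U)"
  by (induction rule: rt_steps.induct) (auto intro: rt_steps.intros rt_step.app_r)

lemma rt_steps_Bind:
  "rt_steps nxt ((b, V) # L) n T U \<Longrightarrow> rt_steps nxt L n (Bind b V T) (Bind b V U)"
  by (induction "(b, V) # L" n T U rule: rt_steps.induct)
    (auto intro: rt_steps.intros rt_step.bind_r)

lemma scoped_rt_steps_one: "scoped L T \<Longrightarrow> \<exists>U. rt_steps nxt L 1 T U"
proof (induction rule: scoped.induct)
  case (Sort L s)
  show ?case by (blast intro: rt_steps.step rt_step.sort)
next
  case (Zero K V b)
  show ?case
  proof (cases b)
    case Abst
    then show ?thesis by (blast intro: rt_steps.step rt_step.ldef)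
  next
    case Abbr
    from Zero.IH obtain U where "rt_steps nxt K 1 V U" by blast
    \<comment> \<open>Unfolding has bound 0, so the bound 1 comes entirely from the reduction of
      \<open>V\<close>.\<close>
    then have "rt_steps nxt ((Abbr, V) # K) (0 + 1) (Var 0) (lift 0 U)"
      by (intro rt_steps.trans[OF rt_steps.step[OF rt_step.delta]] rt_steps_lift_0)
    with Abbr show ?thesis by auto
  qed
next
  case (Suc K i b V)
  then obtain U where "rt_steps nxt K 1 (Var i) U" by blast
  \<comment> \<open>The rule \<open>lref\<close> covers single steps from a variable only; the
    reduction may go on from other terms, so it is lifted as a whole.\<close>
  from rt_steps_lift_0[OF this] show ?case by auto
next
  case (App L V T)
  then show ?case by (blast intro: rt_steps_App)
next
  case (Bind L V b T)
  then show ?case by (blast intro: rt_steps_Bind)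
next
  case (Cast L U T)
  show ?case by (blast intro: rt_steps.step rt_step.ee)
qed

lemma scoped_rt_steps_exists: "scoped L T \<Longrightarrow> \<exists>U. rt_steps nxt L n T U"
proof (induction n arbitrary: T)
  case 0
  show ?case by (blast intro: rt_steps.refl)
next
  case (Suc n)
  from scoped_rt_steps_one[OF Suc.prems] obtain T' where T': "rt_steps nxt L 1 T T'" by blast
  with Suc.prems have "scoped L T'" by (rule scoped_rt_steps[rotated])
  with Suc.IH obtain U where "rt_steps nxt L n T' U" by blast
  with T' have "rt_steps nxt L (1 + n) T U" by (rule rt_steps.trans)
  then show ?case by auto
qed

lemma rt_steps_Lam_extend:
  assumes "scoped L T" and T: "rt_steps nxt L m T (Lam W U)" and "m \<le> n"
  shows "\<exists>U'. rt_steps nxt L n T (Lam W U')"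
proof -
  from scoped_rt_steps[OF T \<open>scoped L T\<close>] have "scoped ((Abst, W) # L) U" by simp
  \<comment> \<open>The missing bound \<open>n - m\<close> is spent in the body, which leaves
    \<open>W\<close> untouched.\<close>
  then obtain U' where "rt_steps nxt ((Abst, W) # L) (n - m) U U'"
    using scoped_rt_steps_exists by blast
  from rt_steps.trans[OF T rt_steps_Bind[OF this]] \<open>m \<le> n\<close> show ?thesis by auto
qed

theorem theorem5p5:
  fixes nxt :: "'s \<Rightarrow> 's" and A1 A2 :: "nat set" and L :: "'s env" and T :: "'s trm"
  assumes "\<forall>m\<in>A1. \<exists>n\<in>A2. m \<le> n"
    and "valid nxt A1 L T"
  shows "valid nxt A2 L T"
  using assms(2)
proof (induction rule: valid.induct)
  \<comment> \<open>Only this rule mentions the set of bounds. Since \<open>W\<close> is kept, the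
    reduction of \<open>V\<close> to \<open>W\<close> at bound 1 is reused as it is.\<close>
  case (app L V T m W U)
  from assms(1) app.hyps obtain n where n: "n \<in> A2" "m \<le> n" by blast
  obtain U' where "rt_steps nxt L n T (Lam W U')"
    using rt_steps_Lam_extend[OF valid_imp_scoped] app.hyps n by blast
  with app n show ?case by (blast intro: valid.app)
qed (auto intro: valid.intros[simplified])

end
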